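(* Let $X$ be a Hermitian graph with Hermitian matrix $H$, let $a,b$ be vertices, and let $\Phi_a=\{\theta_1,\dots,\theta_d\}$. Then $X$ has pretty good state transfer from $a$ to $b$ if and only if (i) $a$ and $b$ are strongly cospectral, with quarrels $q_r(a,b)$ for $r=1,\dots,d$; and (ii) there exists $\delta\in\mathbb{R}$ such that for all integers $l_1,\dots,l_d$ with $\sum_{r=1}^d l_r\theta_r=0$ we have $\sum_{r=1}^d l_r\big(q_r(a,b)+\delta\big)\equiv 0\pmod{2\pi}$.
   Context: A Hermitian graph is given by an arbitrary Hermitian matrix $H$ indexed by its vertices; $U(t)=e^{-itH}$. With spectral decomposition $H=\sum_r\theta_rE_r$ (distinct eigenvalues $\theta_r$, orthogonal projections $E_r$), the eigenvalue support of $a$ is $\Phi_a=\{\theta_r:E_re_a\neq0\}$. Vertices $a,b$ are strongly cospectral if for every $r$ there is $q_r(a,b)\in[0,2\pi)$ with $E_re_a=e^{iq_r(a,b)}E_re_b$; $q_r(a,b)$ is the quarrel from $a$ to $b$ relative to $\theta_r$. There is pretty good state transfer from $a$ to $b$ if for every $\varepsilon>0$ there is a time $\tau$ with $|U(\tau)_{a,b}|\ge1-\varepsilon$. *)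

theory Defs
  imports "HOL-Analysis.Analysis" "HOL-Library.Real_Mod"
begin

definition hermitian :: "complex^'n^'n \<Rightarrow> bool" where
  "hermitian A \<longleftrightarrow> (\<forall>i j. A $ i $ j = cnj (A $ j $ i))"

(* The constant exp of the library does not apply to square matrices, so the power series is
   written out; it converges in the (finite-dimensional) type of matrices. *)
definition matrix_exp :: "complex^'n^'n \<Rightarrow> complex^'n^'n" where
  "matrix_exp A = (\<Sum>k. (1 / fact k) *\<^sub>R (((**) A) ^^ k) (mat 1))"

definition transition_matrix :: "complex^'n^'n \<Rightarrow> real \<Rightarrow> complex^'n^'n" where
  "transition_matrix H t = matrix_exp (map_matrix ((*) (- \<i> * of_real t)) H)"

definition pretty_good_state_transfer :: "complex^'n^'n \<Rightarrow> 'n \<Rightarrow> 'n \<Rightarrow> bool" where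
  "pretty_good_state_transfer H a b \<longleftrightarrow>
     (\<forall>\<epsilon>>0. \<exists>\<tau>::real. cmod (transition_matrix H \<tau> $ a $ b) \<ge> 1 - \<epsilon>)"

(* Eigenvalues are taken in the reals, since those of a Hermitian matrix are real. *)
definition eigenspace :: "complex^'n^'n \<Rightarrow> real \<Rightarrow> (complex^'n) set" where
  "eigenspace H \<theta> = {v. H *v v = of_real \<theta> *s v}"

definition eigenvalue :: "complex^'n^'n \<Rightarrow> real \<Rightarrow> bool" where
  "eigenvalue H \<theta> \<longleftrightarrow> (\<exists>v\<in>eigenspace H \<theta>. v \<noteq> 0)"

(* The matrix of the orthogonal projection onto the eigenspace: the terms E_r of the spectral
   decomposition. It exists and is unique by ex1_eigenprojection below. *)
definition eigenprojection :: "complex^'n^'n \<Rightarrow> real \<Rightarrow> complex^'n^'n" where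
  "eigenprojection H \<theta> =
     (THE P. hermitian P \<and> P ** P = P \<and> range ((*v) P) = eigenspace H \<theta>)"

definition eigenvalue_support :: "complex^'n^'n \<Rightarrow> 'n \<Rightarrow> real set" where
  "eigenvalue_support H a = {\<theta>. eigenvalue H \<theta> \<and> eigenprojection H \<theta> *v axis a 1 \<noteq> 0}"

definition is_quarrel :: "complex^'n^'n \<Rightarrow> 'n \<Rightarrow> 'n \<Rightarrow> real \<Rightarrow> real \<Rightarrow> bool" where
  "is_quarrel H a b \<theta> q \<longleftrightarrow> 0 \<le> q \<and> q < 2 * pi \<and>
     eigenprojection H \<theta> *v axis a 1 = cis q *s (eigenprojection H \<theta> *v axis b 1)"

definition strongly_cospectral :: "complex^'n^'n \<Rightarrow> 'n \<Rightarrow> 'n \<Rightarrow> bool" where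
  "strongly_cospectral H a b \<longleftrightarrow> (\<forall>\<theta>. eigenvalue H \<theta> \<longrightarrow> (\<exists>q. is_quarrel H a b \<theta> q))"

(* Meaningful when a and b are strongly cospectral and theta is in the eigenvalue support of a;
   it is then determined uniquely, see is_quarrel_unique. *)
definition quarrel :: "complex^'n^'n \<Rightarrow> 'n \<Rightarrow> 'n \<Rightarrow> real \<Rightarrow> real" where
  "quarrel H a b \<theta> = (THE q. is_quarrel H a b \<theta> q)"

lemma is_quarrel_unique:
  assumes "\<theta> \<in> eigenvalue_support H a" "is_quarrel H a b \<theta> q" "is_quarrel H a b \<theta> q'"
  shows "q = q'"
proof -
  let ?w = "eigenprojection H \<theta> *v axis b 1"
  have w: "?w \<noteq> 0" "cis q *s ?w = cis q' *s ?w"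
    using assms by (auto simp: eigenvalue_support_def is_quarrel_def)
  then obtain i where "?w $ i \<noteq> 0" by (auto simp: vec_eq_iff)
  moreover have "cis q * ?w $ i = cis q' * ?w $ i"
    using w(2) by (metis vector_smult_component)
  ultimately have "cis q = cis q'" by simp
  thus ?thesis
    using assms(2,3) by (simp add: is_quarrel_def cis_eq_iff rcong_def rmod_idem)
qed

lemma ex1_eigenprojection:
  "\<exists>!P. hermitian P \<and> P ** P = P \<and> range ((*v) P) = eigenspace H \<theta>"
proof -
  define V where "V = eigenspace H \<theta>"
  have scV: "c *s v \<in> V" if "v \<in> V" for c v
    using that by (simp add: V_def eigenspace_def vec.scale vector_smult_assoc mult.commute)
  have addV: "v + w \<in> V" if "v \<in> V" "w \<in> V" for v w
    using that by (simp add: V_def eigenspace_def matrix_vector_right_distrib vector_add_ldistrib)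
  have scR: "r *\<^sub>R v = complex_of_real r *s v" for r and v :: "complex^'a"
    by (simp add: vec_eq_iff scaleR_conv_of_real[symmetric])
  have subV: "subspace V"
    unfolding subspace_def using addV scV scR
    by (simp add: V_def eigenspace_def)
  define f where "f x = (SOME y. y \<in> V \<and> (\<forall>w\<in>V. (x - y) \<bullet> w = 0))" for x
  have f: "f x \<in> V \<and> (\<forall>w\<in>V. (x - f x) \<bullet> w = 0)" for x
  proof -
    obtain y z where "y \<in> span V" "\<And>w. w \<in> span V \<Longrightarrow> orthogonal z w" "x = y + z"
      using orthogonal_subspace_decomp_exists[of V x] by metis
    hence "y \<in> V \<and> (\<forall>w\<in>V. (x - y) \<bullet> w = 0)"
      using subV by (metis add_diff_cancel_left' orthogonal_def span_eq_iff)
    thus ?thesis unfolding f_def by (rule someI)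
  qed
  have uniq: "y = f x" if "y \<in> V" "\<forall>w\<in>V. (x - y) \<bullet> w = 0" for x y
  proof -
    have "y - f x \<in> V" using that f subV by (simp add: subspace_diff)
    hence "(x - f x) \<bullet> (y - f x) - (x - y) \<bullet> (y - f x) = 0" using that f by simp
    hence "(y - f x) \<bullet> (y - f x) = 0" by (simp add: algebra_simps)
    thus ?thesis by simp
  qed
  have innc: "(c *s x) \<bullet> y = x \<bullet> (cnj c *s y)" for c and x y :: "complex^'a"
    by (simp add: inner_vec_def inner_complex_def algebra_simps)
  have fadd: "f (x + y) = f x + f y" for x y
  proof (rule uniq[symmetric])
    show "f x + f y \<in> V" using f addV by blast
    show "\<forall>w\<in>V. (x + y - (f x + f y)) \<bullet> w = 0"
      using f[of x] f[of y] by (simp add: algebra_simps)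
  qed
  have fsc: "f (c *s x) = c *s f x" for c x
  proof (rule uniq[symmetric])
    show "c *s f x \<in> V" using f scV by blast
    show "\<forall>w\<in>V. (c *s x - c *s f x) \<bullet> w = 0"
      using f[of x] scV by (simp only: vec.scale_right_diff_distrib[symmetric] innc) blast
  qed
  have lin: "Vector_Spaces.linear (*s) (*s) f"
    by unfold_locales (auto simp: fadd fsc vec.scale_right_distrib vec.scale_left_distrib)
  define P where "P = matrix f"
  have P: "P *v x = f x" for x unfolding P_def by (rule matrix_works[OF lin])
  have sa: "f x \<bullet> y = x \<bullet> f y" for x y
  proof -
    have "(y - f y) \<bullet> f x = 0" "(x - f x) \<bullet> f y = 0" using f by blast+
    thus ?thesis by (simp add: algebra_simps inner_commute)
  qed
  have entry: "P $ i $ j = f (axis j 1) $ i" for i j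
    by (simp add: P_def matrix_def)
  have herm: "hermitian P"
    unfolding hermitian_def
  proof (intro allI)
    fix i j
    have 1: "f (axis j 1) \<bullet> axis i 1 = axis j 1 \<bullet> f (axis i 1)" by (rule sa)
    have ax: "axis i \<i> = \<i> *s axis i (1::complex)" by (simp add: vec_eq_iff axis_def)
    have "f (axis j 1) \<bullet> axis i \<i> = axis j 1 \<bullet> (\<i> *s f (axis i 1))"
      unfolding ax by (simp only: sa fsc)
    with 1 show "P $ i $ j = cnj (P $ j $ i)"
      by (simp add: entry complex_eq_iff inner_axis inner_axis' inner_complex_def)
  qed
  have fV: "f v = v" if "v \<in> V" for v by (rule uniq[symmetric]) (use that in simp_all)
  have idem: "P ** P = P"
    by (simp add: matrix_eq matrix_vector_mul_assoc[symmetric] P fV f)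
  have rng: "range ((*v) P) = V"
  proof
    show "range ((*v) P) \<subseteq> V" using f P by auto
    show "V \<subseteq> range ((*v) P)" using fV P by (metis rangeI subsetI)
  qed
  have uni: "Q = R" if Q: "hermitian Q" "Q ** Q = Q" "range ((*v) Q) = V"
    and R: "hermitian R" "R ** R = R" "range ((*v) R) = V" for Q R :: "complex^'a^'a"
  proof -
    have abs: "A ** B = B" if AB: "A ** A = A" "range ((*v) A) = V" "range ((*v) B) = V"
      for A B :: "complex^'a^'a"
    proof -
      have "A *v (B *v x) = B *v x" for x
      proof -
        obtain y where "B *v x = A *v y" using AB(2,3) by blast
        thus ?thesis using AB(1) by (simp add: matrix_vector_mul_assoc)
      qed
      thus ?thesis by (simp add: matrix_eq matrix_vector_mul_assoc[symmetric])
    qed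
    have QR: "Q ** R = R" "R ** Q = Q" using abs Q R by blast+
    have "(Q ** R) $ i $ j = cnj ((R ** Q) $ j $ i)" for i j
    proof -
      have "Q $ i $ k * R $ k $ j = cnj (R $ j $ k * Q $ k $ i)" for k
        using Q(1) R(1) unfolding hermitian_def by (metis complex_cnj_mult mult.commute)
      thus ?thesis by (simp add: matrix_matrix_mult_def)
    qed
    hence "R $ i $ j = Q $ i $ j" for i j
      using QR Q(1) by (metis hermitian_def)
    thus ?thesis by (simp add: vec_eq_iff)
  qed
  show ?thesis using herm idem rng uni unfolding V_def by blast
qed

end

theory Submission
  imports Defs
begin

text \<open>By the spectral decomposition, \<open>U(t) e\<^sub>b = \<Sum>\<theta>. exp(-i t \<theta>) E\<^sub>\<theta> e\<^sub>b\<close>. If the modulus of the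
  \<open>a\<close>-entry of this vector tends to 1 along a sequence of times, pass to a subsequence along which
  every phase converges, say to \<open>\<zeta>\<^sub>\<theta>\<close>. The unit vector \<open>\<Sum>\<theta>. \<zeta>\<^sub>\<theta> E\<^sub>\<theta> e\<^sub>b\<close> then has an entry of
  modulus 1 at \<open>a\<close>, so it is \<open>\<gamma> e\<^sub>a\<close> with \<open>\<gamma>\<close> unimodular. Comparing projections gives strong
  cospectrality, with \<open>\<zeta>\<^sub>\<theta> = exp(i (q\<^sub>\<theta> + \<delta>))\<close> for \<open>\<delta> = arg \<gamma>\<close>, and every integer relation
  between the eigenvalues passes to the limit phases. Conversely, Kronecker's theorem for possibly
  dependent frequencies yields times at which all phases are close to \<open>exp(i (q\<^sub>\<theta> + \<delta>))\<close>, and with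
  these exact phases the \<open>a\<close>-entry would be \<open>exp(i \<delta>)\<close>.\<close>

section \<open>Kronecker's theorem for dependent frequencies\<close>

text \<open>For finite \<open>I\<close>, this says that the point \<alpha> of the torus (R/Z)^I lies
  in the closure of the line through the origin with direction \<theta>.\<close>

definition kronecker_approximable :: "'a set \<Rightarrow> ('a \<Rightarrow> real) \<Rightarrow> ('a \<Rightarrow> real) \<Rightarrow> bool" where
  "kronecker_approximable I \<theta> \<alpha> \<longleftrightarrow>
     (\<forall>\<epsilon>>0. \<exists>t h. \<forall>i\<in>I. \<bar>t * \<theta> i - of_int (h i) - \<alpha> i\<bar> < \<epsilon>)"

text \<open>Bridge to the classical \<open>Kronecker_thm_1\<close>, which numbers the frequencies by
  naturals and speaks of independence of the set of their values. Distinctness of the frequencies is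
  therefore extracted from \<open>triv\<close>: two equal ones satisfy the relation with
  coefficients 1 and -1.\<close>

lemma kronecker_approximable_independent:
  fixes \<theta> \<alpha> :: "'a \<Rightarrow> real"
  assumes fin: "finite I"
    and triv: "\<And>l::'a \<Rightarrow> int. (\<Sum>i\<in>I. of_int (l i) * \<theta> i) = 0 \<Longrightarrow> \<forall>i\<in>I. l i = 0"
  shows "kronecker_approximable I \<theta> \<alpha>"
  unfolding kronecker_approximable_def
proof (intro allI impI)
  fix \<epsilon> :: real assume "\<epsilon> > 0"
  \<comment> \<open>Independence is meant over the integers, with the reals as a module over
    them.\<close>
  interpret Modules.module "(\<lambda>r. (*) (real_of_int r))"
    by (simp add: Modules.module.intro distrib_left mult.commute)
  obtain g where g: "bij_betw g {..<card I} I"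
    using ex_bij_betw_nat_finite[OF fin] atLeast0LessThan by metis
  have inj: "inj_on \<theta> I"
  proof (rule inj_onI, rule ccontr)
    fix i j assume ij: "i \<in> I" "j \<in> I" "\<theta> i = \<theta> j" "i \<noteq> j"
    define l :: "'a \<Rightarrow> int" where "l k = of_bool (k = i) - of_bool (k = j)" for k
    have "(\<Sum>k\<in>I. of_int (l k) * \<theta> k) =
        (\<Sum>k\<in>I. if k = i then \<theta> k else 0) - (\<Sum>k\<in>I. if k = j then \<theta> k else 0)"
      unfolding sum_subtractf[symmetric] by (rule sum.cong) (auto simp: l_def)
    hence "(\<Sum>k\<in>I. of_int (l k) * \<theta> k) = 0" using fin ij by simp
    from triv[OF this] ij show False by (auto simp: l_def)
  qed
  have ind: "independent (\<theta> ` I)"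
  proof
    assume "dependent (\<theta> ` I)"
    then obtain T u where T: "finite T" "T \<subseteq> \<theta> ` I" "(\<Sum>v\<in>T. of_int (u v) * v) = 0"
      "\<exists>v\<in>T. u v \<noteq> 0"
      unfolding dependent_explicit by blast
    \<comment> \<open>Carries a dependency among values back to the indices, with coefficient 0 for
      values outside \<open>T\<close>.\<close>
    define l where "l i = (if \<theta> i \<in> T then u (\<theta> i) else 0)" for i
    have "(\<Sum>i\<in>I. of_int (l i) * \<theta> i) = (\<Sum>v\<in>\<theta> ` I. of_int (if v \<in> T then u v else 0) * v)"
      by (simp add: sum.reindex[OF inj] l_def)
    also have "\<dots> = (\<Sum>v\<in>T. of_int (u v) * v)"
      by (rule sum.mono_neutral_cong_right) (use fin T in auto)
    finally have "\<forall>i\<in>I. l i = 0" using triv T(3) by simp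
    thus False using T(2,4) by (force simp: l_def)
  qed
  have img: "(\<theta> \<circ> g) ` {..<card I} = \<theta> ` I"
    using g by (metis bij_betw_imp_surj_on image_comp)
  have "inj_on (\<theta> \<circ> g) {..<card I}"
    using g inj by (metis bij_betw_def comp_inj_on)
  then obtain t h where th: "\<And>i. i < card I \<Longrightarrow> \<bar>t * (\<theta> \<circ> g) i - of_int (h i) - (\<alpha> \<circ> g) i\<bar> < \<epsilon>"
    using Kronecker_thm_1[of "\<theta> \<circ> g" "card I" \<epsilon> "\<alpha> \<circ> g"] ind \<open>\<epsilon> > 0\<close> unfolding img by metis
  have "\<bar>t * \<theta> i - of_int (h (inv_into {..<card I} g i)) - \<alpha> i\<bar> < \<epsilon>" if "i \<in> I" for i
    using th[of "inv_into {..<card I} g i"] that bij_betw_inv_into_right[OF g that]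
      bij_betw_apply[OF bij_betw_inv_into[OF g] that] by simp
  thus "\<exists>t h. \<forall>i\<in>I. \<bar>t * \<theta> i - of_int (h i) - \<alpha> i\<bar> < \<epsilon>"
    by (intro exI[of _ t] exI[of _ "\<lambda>i. h (inv_into {..<card I} g i)"]) blast
qed

text \<open>A shear is an integer change of coordinates with integer inverse, so it acts on the
  torus and approximations can be pulled back along it. Undoing it multiplies the error by at most
  \<open>1 + \<bar>s\<bar>\<close>, which dictates \<epsilon>'.\<close>

lemma kronecker_approximable_shear:
  fixes s :: int and \<theta> \<alpha> :: "'a \<Rightarrow> real"
  assumes "i \<in> I" "i \<noteq> j"
    and "kronecker_approximable I (\<theta>(j := \<theta> j + s * \<theta> i)) (\<alpha>(j := \<alpha> j + s * \<alpha> i))"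
  shows "kronecker_approximable I \<theta> \<alpha>"
  unfolding kronecker_approximable_def
proof (intro allI impI)
  fix \<epsilon> :: real assume "\<epsilon> > 0"
  define \<epsilon>' where "\<epsilon>' = \<epsilon> / (1 + \<bar>s\<bar>)"
  have \<epsilon>': "\<epsilon>' > 0" "\<epsilon>' * (1 + \<bar>s\<bar>) = \<epsilon>" using \<open>\<epsilon> > 0\<close> by (auto simp: \<epsilon>'_def)
  obtain t h where th: "\<And>k. k \<in> I \<Longrightarrow>
      \<bar>t * (\<theta>(j := \<theta> j + s * \<theta> i)) k - of_int (h k) - (\<alpha>(j := \<alpha> j + s * \<alpha> i)) k\<bar> < \<epsilon>'"
    using assms(3) \<epsilon>'(1) unfolding kronecker_approximable_def by blast
  have i: "\<bar>t * \<theta> i - of_int (h i) - \<alpha> i\<bar> < \<epsilon>'"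
    using th[OF assms(1)] assms(2) by simp
  have "\<bar>t * \<theta> k - of_int ((h(j := h j - s * h i)) k) - \<alpha> k\<bar> < \<epsilon>" if "k \<in> I" for k
  proof (cases "k = j")
    case False
    have "\<epsilon>' * 1 \<le> \<epsilon>' * (1 + \<bar>s\<bar>)" using \<epsilon>'(1) by (intro mult_left_mono) auto
    hence "\<epsilon>' \<le> \<epsilon>" using \<epsilon>'(2) by simp
    with th[OF that] False show ?thesis by simp
  next
    case True
    have "\<bar>t * \<theta> j - of_int (h j - s * h i) - \<alpha> j\<bar> =
        \<bar>(t * (\<theta> j + s * \<theta> i) - of_int (h j) - (\<alpha> j + s * \<alpha> i)) - s * (t * \<theta> i - of_int (h i) - \<alpha> i)\<bar>"
      by (simp add: algebra_simps)
    also have "\<dots> \<le> \<bar>t * (\<theta> j + s * \<theta> i) - of_int (h j) - (\<alpha> j + s * \<alpha> i)\<bar> +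
        \<bar>s\<bar> * \<bar>t * \<theta> i - of_int (h i) - \<alpha> i\<bar>"
      by (metis abs_triangle_ineq4 abs_mult of_int_abs)
    also have "\<dots> < \<epsilon>' + \<bar>s\<bar> * \<epsilon>'"
      using th[OF that] True i by (intro add_less_le_mono mult_left_mono) auto
    finally show ?thesis using True \<epsilon>'(2) by (simp add: algebra_simps)
  qed
  thus "\<exists>t h. \<forall>i\<in>I. \<bar>t * \<theta> i - of_int (h i) - \<alpha> i\<bar> < \<epsilon>" by blast
qed

text \<open>A coordinate of frequency 0 never moves, and the integer \<open>- \<alpha> i\<close>
  makes its error exactly zero.\<close>

lemma kronecker_approximable_insert_zero:
  assumes "\<theta> i = 0" "\<alpha> i \<in> \<int>" "kronecker_approximable I \<theta> \<alpha>"
  shows "kronecker_approximable (insert i I) \<theta> \<alpha>"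
  unfolding kronecker_approximable_def
proof (intro allI impI)
  fix \<epsilon> :: real assume "\<epsilon> > 0"
  then obtain t h where th: "\<forall>k\<in>I. \<bar>t * \<theta> k - of_int (h k) - \<alpha> k\<bar> < \<epsilon>"
    using assms(3) unfolding kronecker_approximable_def by blast
  obtain m where "\<alpha> i = of_int m" using assms(2) by (elim Ints_cases)
  with th assms(1) \<open>\<epsilon> > 0\<close>
  have "\<forall>k\<in>insert i I. \<bar>t * \<theta> k - of_int ((h(i := - m)) k) - \<alpha> k\<bar> < \<epsilon>" by auto
  thus "\<exists>t h. \<forall>k\<in>insert i I. \<bar>t * \<theta> k - of_int (h k) - \<alpha> k\<bar> < \<epsilon>" by blast
qed

text \<open>The coefficients undergo the transposed inverse of the shear applied to
  \<open>x\<close>, so their pairing is unchanged. This transports integer relations between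
  original and sheared frequencies.\<close>

lemma sum_shear:
  fixes s :: int and l :: "'a \<Rightarrow> int" and x :: "'a \<Rightarrow> real"
  assumes "finite I" "i \<in> I" "j \<in> I" "i \<noteq> j"
  shows "(\<Sum>k\<in>I. of_int ((l(i := l i - s * l j)) k) * (x(j := x j + s * x i)) k) =
    (\<Sum>k\<in>I. of_int (l k) * x k)"
proof -
  have I: "I = insert i (insert j (I - {i, j}))" using assms by auto
  have "(\<Sum>k\<in>I - {i, j}. of_int ((l(i := l i - s * l j)) k) * (x(j := x j + s * x i)) k) =
      (\<Sum>k\<in>I - {i, j}. of_int (l k) * x k)"
    by (rule sum.cong) auto
  thus ?thesis using assms by (subst (1 2) I) (simp add: algebra_simps)
qed

text \<open>A nontrivial integer relation is shortened by Euclid's algorithm on its coefficients, carried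
  out by shears of the frequencies, until it says that a single frequency vanishes.\<close>
lemma kronecker_approximable_step:
  fixes \<theta> \<alpha> :: "'a \<Rightarrow> real" and l :: "'a \<Rightarrow> int"
  assumes fin: "finite I"
    and rel: "\<And>l::'a \<Rightarrow> int. (\<Sum>i\<in>I. of_int (l i) * \<theta> i) = 0 \<Longrightarrow> (\<Sum>i\<in>I. of_int (l i) * \<alpha> i) \<in> \<int>"
    and IH: "\<And>J \<theta> \<alpha>. J \<subset> I \<Longrightarrow>
      (\<And>l::'a \<Rightarrow> int. (\<Sum>i\<in>J. of_int (l i) * \<theta> i) = 0 \<Longrightarrow> (\<Sum>i\<in>J. of_int (l i) * \<alpha> i) \<in> \<int>) \<Longrightarrow>
      kronecker_approximable J \<theta> \<alpha>"
    and l: "(\<Sum>i\<in>I. of_int (l i) * \<theta> i) = 0" "i0 \<in> I" "l i0 \<noteq> 0"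
  shows "kronecker_approximable I \<theta> \<alpha>"
  using rel l
\<comment> \<open>The measure is the total absolute size of the coefficients; \<theta> and \<alpha>
  are generalised because every shear replaces them.\<close>
proof (induction "\<Sum>i\<in>I. nat \<bar>l i\<bar>" arbitrary: \<theta> \<alpha> l i0 rule: less_induct)
  case less
  note rel = less.prems(1) and l = less.prems(2-4)
  show ?case
  proof (cases "\<exists>j\<in>I. j \<noteq> i0 \<and> l j \<noteq> 0")
    \<comment> \<open>Only one coefficient is nonzero, so its frequency vanishes and can be split
      off from the index set.\<close>
    case False
    have "(\<Sum>i\<in>I. of_int (l i) * \<theta> i) = (\<Sum>i\<in>{i0}. of_int (l i) * \<theta> i)"
      by (rule sum.mono_neutral_right) (use fin l False in auto)
    with l have \<theta>0: "\<theta> i0 = 0" by simp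
    have split: "(\<Sum>i\<in>I. of_int (m i) * x i) = of_int (m i0) * x i0 + (\<Sum>i\<in>I - {i0}. of_int (m i) * x i)"
      for m :: "'a \<Rightarrow> int" and x :: "'a \<Rightarrow> real"
      by (rule sum.remove) (use fin l in auto)
    have ind: "(\<Sum>i\<in>I - {i0}. of_int ((m(i0 := c)) i) * x i) = (\<Sum>i\<in>I - {i0}. of_int (m i) * x i)"
      for m :: "'a \<Rightarrow> int" and x :: "'a \<Rightarrow> real" and c
      by (rule sum.cong) auto
    \<comment> \<open>The relation with coefficient 1 at \<open>i0\<close> and 0 elsewhere holds
      because \<open>\<theta> i0 = 0\<close>.\<close>
    have "\<alpha> i0 \<in> \<int>"
      using rel[of "(\<lambda>_. 0)(i0 := 1)"] \<theta>0 by (simp add: split ind del: fun_upd_apply) (simp add: fun_upd_def)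
    moreover have "kronecker_approximable (I - {i0}) \<theta> \<alpha>"
    proof (rule IH)
      show "I - {i0} \<subset> I" using l by auto
      fix m :: "'a \<Rightarrow> int" assume "(\<Sum>i\<in>I - {i0}. of_int (m i) * \<theta> i) = 0"
      thus "(\<Sum>i\<in>I - {i0}. of_int (m i) * \<alpha> i) \<in> \<int>"
        using rel[of "m(i0 := 0)"] unfolding split ind by simp
    qed
    ultimately show ?thesis
      using kronecker_approximable_insert_zero[of \<theta> i0 \<alpha> "I - {i0}"] \<theta>0 l by (simp add: insert_absorb)
  next
    case True
    then obtain i j where ij: "i \<in> I" "j \<in> I" "i \<noteq> j" "l j \<noteq> 0" "\<bar>l j\<bar> \<le> \<bar>l i\<bar>"
      using l by (metis linear)
    \<comment> \<open>This sign gives \<open>s * l j\<close> the sign of \<open>l i\<close>. As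
      \<open>l j\<close> is nonzero and no larger in absolute value, subtracting it strictly shrinks
      \<open>l i\<close>, while the untouched \<open>l j\<close> keeps the relation
      nontrivial.\<close>
    define s where "s = sgn (l i) * sgn (l j)"
    define l' where "l' = l(i := l i - s * l j)"
    define \<theta>' where "\<theta>' = \<theta>(j := \<theta> j + s * \<theta> i)"
    define \<alpha>' where "\<alpha>' = \<alpha>(j := \<alpha> j + s * \<alpha> i)"
    have smaller: "\<bar>l i - s * l j\<bar> < \<bar>l i\<bar>"
      using ij by (auto simp: s_def sgn_if split: if_splits)
    have "kronecker_approximable I \<theta>' \<alpha>'"
    proof (rule less.hyps[of l'])
      show "(\<Sum>k\<in>I. nat \<bar>l' k\<bar>) < (\<Sum>k\<in>I. nat \<bar>l k\<bar>)"
        by (rule sum_strict_mono_ex1) (use fin ij smaller in \<open>auto simp: l'_def\<close>)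
      show "(\<Sum>k\<in>I. of_int (l' k) * \<theta>' k) = 0"
        unfolding l'_def \<theta>'_def sum_shear[OF fin ij(1-3)] by (rule l)
      show "j \<in> I" "l' j \<noteq> 0" using ij by (auto simp: l'_def)
      fix m :: "'a \<Rightarrow> int" assume m: "(\<Sum>k\<in>I. of_int (m k) * \<theta>' k) = 0"
      \<comment> \<open>The inverse shear turns a relation \<open>m\<close> of the new frequencies
        into one of the old ones, to which \<open>rel\<close> applies.\<close>
      define n where "n = m(i := m i + s * m j)"
      have mn: "m = n(i := n i - s * n j)" using ij by (auto simp: n_def)
      show "(\<Sum>k\<in>I. of_int (m k) * \<alpha>' k) \<in> \<int>"
        using m rel[of n] sum_shear[OF fin ij(1-3), of n s]
        unfolding \<theta>'_def \<alpha>'_def mn[symmetric] by metis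
    qed
    thus ?thesis unfolding \<theta>'_def \<alpha>'_def by (rule kronecker_approximable_shear[OF ij(1,3)])
  qed
qed

text \<open>Strong induction on the index set. Without a nontrivial relation every target is
  reachable; otherwise the relation is reduced until one frequency vanishes and a smaller index set
  remains.\<close>

theorem kronecker_approximable_if_relations:
  fixes \<theta> \<alpha> :: "'a \<Rightarrow> real"
  assumes "finite I"
    and "\<And>l::'a \<Rightarrow> int. (\<Sum>i\<in>I. of_int (l i) * \<theta> i) = 0 \<Longrightarrow> (\<Sum>i\<in>I. of_int (l i) * \<alpha> i) \<in> \<int>"
  shows "kronecker_approximable I \<theta> \<alpha>"
  using assms
proof (induction I arbitrary: \<theta> \<alpha> rule: finite_psubset_induct)
  case (psubset I)
  show ?case
  proof (cases "\<forall>l::'a \<Rightarrow> int. (\<Sum>i\<in>I. of_int (l i) * \<theta> i) = 0 \<longrightarrow> (\<forall>i\<in>I. l i = 0)")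
    case True
    thus ?thesis using kronecker_approximable_independent[OF psubset.hyps] by blast
  next
    case False
    then obtain l :: "'a \<Rightarrow> int" and i0 where "(\<Sum>i\<in>I. of_int (l i) * \<theta> i) = 0" "i0 \<in> I" "l i0 \<noteq> 0"
      by blast
    thus ?thesis
      using kronecker_approximable_step[OF psubset.hyps psubset.prems psubset.IH] by blast
  qed
qed

section \<open>Spectral decomposition of Hermitian matrices\<close>

text \<open>Maximise the Rayleigh quotient over the compact unit sphere of \<open>S\<close>. With
  \<mu> its maximum, the form \<open>\<mu> * (y \<bullet> y) - f y \<bullet> y\<close> is
  nonnegative on \<open>S\<close> and zero at the maximiser \<open>x\<close>, so its first variation
  there must vanish.\<close>

lemma symmetric_eigenvector_exists:
  fixes f :: "'a::euclidean_space \<Rightarrow> 'a"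
  assumes lin: "linear f" and sym: "\<And>x y. f x \<bullet> y = x \<bullet> f y"
    and S: "subspace S" "\<And>x. x \<in> S \<Longrightarrow> f x \<in> S" and nz: "S \<noteq> {0}"
  obtains \<mu> v where "v \<in> S" "v \<noteq> 0" "f v = \<mu> *\<^sub>R v"
proof -
  define K where "K = S \<inter> sphere 0 1"
  obtain w where w: "w \<in> S" "w \<noteq> 0" using nz subspace_0[OF S(1)] by blast
  have "(1 / norm w) *\<^sub>R w \<in> K" using w by (simp add: K_def subspace_scale[OF S(1)])
  moreover have "compact K"
    unfolding K_def using closed_subspace[OF S(1)] by (simp add: closed_Int_compact)
  moreover have "continuous_on K (\<lambda>x. f x \<bullet> x)"
    using linear_continuous_on[of f K] lin by (intro continuous_intros) (simp add: linear_conv_bounded_linear)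
  ultimately obtain x where x: "x \<in> K" and max: "\<And>y. y \<in> K \<Longrightarrow> f y \<bullet> y \<le> f x \<bullet> x"
    using continuous_attains_sup[of K "\<lambda>x. f x \<bullet> x"] by blast
  define \<mu> where "\<mu> = f x \<bullet> x"
  have x': "x \<in> S" "x \<bullet> x = 1" using x by (auto simp: K_def dot_square_norm)
  have nonneg: "0 \<le> \<mu> * (y \<bullet> y) - f y \<bullet> y" if y: "y \<in> S" for y
  proof (cases "y = 0")
    case False
    have "(1 / norm y) *\<^sub>R y \<in> K" using y False by (simp add: K_def subspace_scale[OF S(1)])
    from max[OF this] have "(f y \<bullet> y) / (norm y)\<^sup>2 \<le> \<mu>"
      by (simp add: \<mu>_def linear_scale[OF lin] power2_eq_square)
    thus ?thesis using False by (simp add: divide_le_eq dot_square_norm)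
  qed (simp add: linear_0[OF lin])
  \<comment> \<open>The residual of the eigenvalue equation at \<open>x\<close>; by invariance it is
    an admissible direction of variation.\<close>
  define z where "z = \<mu> *\<^sub>R x - f x"
  have zS: "z \<in> S" unfolding z_def using S x' by (simp add: subspace_diff subspace_scale)
  define C where "C = \<mu> * (z \<bullet> z) - f z \<bullet> z"
  have zz: "z \<bullet> z = \<mu> * (x \<bullet> z) - f x \<bullet> z" by (simp add: z_def algebra_simps)
  \<comment> \<open>The nonnegative form along \<open>x + t *\<^sub>R z\<close>: its constant term
    is zero and its linear coefficient is twice \<open>z \<bullet> z\<close>.\<close>
  have quad: "0 \<le> 2 * t * (z \<bullet> z) + t\<^sup>2 * C" for t
  proof -
    have "x + t *\<^sub>R z \<in> S" using S(1) x' zS by (simp add: subspace_add subspace_scale)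
    note nonneg[OF this]
    also have "\<mu> * ((x + t *\<^sub>R z) \<bullet> (x + t *\<^sub>R z)) - f (x + t *\<^sub>R z) \<bullet> (x + t *\<^sub>R z) =
        (\<mu> * (x \<bullet> x) - f x \<bullet> x) + 2 * t * (\<mu> * (x \<bullet> z) - f x \<bullet> z) + t\<^sup>2 * C"
      using sym[of z x]
      by (simp add: linear_add[OF lin] linear_scale[OF lin] C_def inner_add_left inner_add_right
          inner_commute[of z x] inner_commute[of z "f x"] algebra_simps power2_eq_square)
    finally show ?thesis using x'(2) zz by (simp add: \<mu>_def)
  qed
  have "z \<bullet> z \<le> 0"
  proof (rule ccontr)
    assume "\<not> ?thesis"
    hence pos: "z \<bullet> z > 0" by linarith
    \<comment> \<open>With \<open>D\<close> above \<open>C\<close>, the choice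
      \<open>t = - (z \<bullet> z) / D\<close> is small enough for the linear term to outweigh the
      quadratic one.\<close>
    define D where "D = \<bar>C\<bar> + 1"
    have D: "D > 0" "C < D" by (auto simp: D_def)
    have "0 \<le> 2 * (- (z \<bullet> z) / D) * (z \<bullet> z) + (- (z \<bullet> z) / D)\<^sup>2 * C" by (rule quad)
    also have "\<dots> = ((z \<bullet> z)\<^sup>2 / D) * (C / D - 2)"
      using D by (simp add: field_simps power2_eq_square)
    also have "\<dots> < 0" using D pos by (intro mult_pos_neg) (auto simp: field_simps)
    finally show False by simp
  qed
  hence "z = 0" by (meson inner_gt_zero_iff not_le)
  moreover have "x \<noteq> 0" using x'(2) by auto
  ultimately show thesis using that[of x \<mu>] x' by (simp add: z_def)
qed

lemma scaleR_vec_complex: "r *\<^sub>R v = complex_of_real r *s v" for v :: "complex^'n"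
  by (simp add: vec_eq_iff scaleR_conv_of_real[symmetric])

lemma linear_matrix_vector_complex: "linear ((*v) (A :: complex^'n^'m))"
  by (rule linearI) (simp_all add: matrix_vector_right_distrib scaleR_vec_complex vec.scale)

text \<open>On complex vectors \<open>\<bullet>\<close> is the real part of the Hermitian form, so
  self-adjointness for the latter suffices. It opens the real Euclidean theory to complex
  eigenspaces.\<close>

lemma hermitian_inner:
  fixes A :: "complex^'n^'n"
  assumes "hermitian A"
  shows "(A *v x) \<bullet> y = x \<bullet> (A *v y)"
proof -
  have inner: "u \<bullet> v = Re (\<Sum>i\<in>UNIV. u $ i * cnj (v $ i))" for u v :: "complex^'n"
    by (simp add: inner_vec_def inner_complex_def)
  have "(\<Sum>i\<in>UNIV. (A *v x) $ i * cnj (y $ i)) = (\<Sum>i\<in>UNIV. \<Sum>j\<in>UNIV. A $ i $ j * x $ j * cnj (y $ i))"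
    by (simp add: matrix_vector_mult_def sum_distrib_right)
  also have "\<dots> = (\<Sum>j\<in>UNIV. \<Sum>i\<in>UNIV. A $ i $ j * x $ j * cnj (y $ i))" by (rule sum.swap)
  also have "\<dots> = (\<Sum>j\<in>UNIV. x $ j * cnj ((A *v y) $ j))"
  proof (intro sum.cong refl)
    fix j
    have "A $ i $ j * x $ j * cnj (y $ i) = x $ j * cnj (A $ j $ i * y $ i)" for i
      using assms unfolding hermitian_def by (metis (no_types) complex_cnj_cnj complex_cnj_mult mult.assoc mult.commute)
    thus "(\<Sum>i\<in>UNIV. A $ i $ j * x $ j * cnj (y $ i)) = x $ j * cnj ((A *v y) $ j)"
      by (simp only: matrix_vector_mult_def sum_distrib_left cnj_sum vec_lambda_beta)
  qed
  finally show ?thesis by (simp add: inner)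
qed

section \<open>Eigenprojections and the resolution of the identity\<close>

lemma
  shows hermitian_eigenprojection: "hermitian (eigenprojection H \<theta>)"
    and eigenprojection_idem: "eigenprojection H \<theta> ** eigenprojection H \<theta> = eigenprojection H \<theta>"
    and range_eigenprojection: "range ((*v) (eigenprojection H \<theta>)) = eigenspace H \<theta>"
  using theI'[OF ex1_eigenprojection[of H \<theta>]] unfolding eigenprojection_def by blast+

lemma eigenprojection_in: "eigenprojection H \<theta> *v x \<in> eigenspace H \<theta>"
  using range_eigenprojection by blast

lemma eigenprojection_eigen:
  "H *v (eigenprojection H \<theta> *v x) = of_real \<theta> *s (eigenprojection H \<theta> *v x)"
  using eigenprojection_in[of H \<theta> x] by (simp add: eigenspace_def)

lemma eigenprojection_fix:
  assumes "v \<in> eigenspace H \<theta>"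
  shows "eigenprojection H \<theta> *v v = v"
proof -
  obtain x where "v = eigenprojection H \<theta> *v x" using assms range_eigenprojection by blast
  thus ?thesis by (simp add: matrix_vector_mul_assoc eigenprojection_idem)
qed

lemma eigenspace_orthogonal:
  assumes "hermitian H" "v \<in> eigenspace H \<theta>" "w \<in> eigenspace H \<eta>" "\<theta> \<noteq> \<eta>"
  shows "v \<bullet> w = 0"
  using hermitian_inner[OF assms(1), of v w] assms(2-4)
  by (simp add: eigenspace_def scaleR_vec_complex[symmetric])

text \<open>The squared norm of the projected vector is an inner product of \<open>v\<close> with an
  element of the eigenspace of \<theta>, which is orthogonal to \<open>v\<close>.\<close>

lemma eigenprojection_other:
  assumes "hermitian H" "v \<in> eigenspace H \<eta>" "\<theta> \<noteq> \<eta>"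
  shows "eigenprojection H \<theta> *v v = 0"
proof -
  let ?w = "eigenprojection H \<theta> *v v"
  have "?w \<bullet> ?w = v \<bullet> (eigenprojection H \<theta> *v ?w)" by (rule hermitian_inner[OF hermitian_eigenprojection])
  also have "\<dots> = 0" using eigenspace_orthogonal[OF assms(1,2) eigenprojection_in] assms(3) by metis
  finally show ?thesis by simp
qed

text \<open>One nonzero eigenvector per eigenvalue gives a pairwise orthogonal, hence independent,
  family in a finite-dimensional real space.\<close>

lemma finite_eigenvalues:
  assumes "hermitian H"
  shows "finite {\<theta>. eigenvalue H \<theta>}"
proof -
  have "\<forall>\<theta>. \<exists>v. eigenvalue H \<theta> \<longrightarrow> v \<in> eigenspace H \<theta> \<and> v \<noteq> 0"
    unfolding eigenvalue_def by blast
  then obtain f where f: "\<And>\<theta>. eigenvalue H \<theta> \<Longrightarrow> f \<theta> \<in> eigenspace H \<theta> \<and> f \<theta> \<noteq> 0"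
    by metis
  let ?L = "{\<theta>. eigenvalue H \<theta>}"
  have orth: "f \<theta> \<bullet> f \<eta> = 0" if "\<theta> \<in> ?L" "\<eta> \<in> ?L" "\<theta> \<noteq> \<eta>" for \<theta> \<eta>
    by (rule eigenspace_orthogonal[OF assms _ _ that(3)]) (use f that in auto)
  have "inj_on f ?L"
    using orth f by (metis (mono_tags, lifting) inj_onI inner_eq_zero_iff mem_Collect_eq)
  moreover have "independent (f ` ?L)"
  proof (rule pairwise_orthogonal_independent)
    show "pairwise orthogonal (f ` ?L)"
      using orth by (auto simp: pairwise_def orthogonal_def)
    show "0 \<notin> f ` ?L" using f by auto
  qed
  ultimately show ?thesis using finiteI_independent finite_imageD by blast
qed

lemma finite_eigenvalue_support:
  assumes "hermitian H"
  shows "finite (eigenvalue_support H a)"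
  by (rule finite_subset[OF _ finite_eigenvalues[OF assms]]) (auto simp: eigenvalue_support_def)

lemma eigenprojection_combination:
  assumes H: "hermitian H" and \<eta>: "eigenvalue H \<eta>"
  shows "eigenprojection H \<eta> *v (\<Sum>\<theta> | eigenvalue H \<theta>. c \<theta> *s (eigenprojection H \<theta> *v x)) =
    c \<eta> *s (eigenprojection H \<eta> *v x)"
proof -
  let ?E = "eigenprojection H"
  have "?E \<eta> *v (\<Sum>\<theta> | eigenvalue H \<theta>. c \<theta> *s (?E \<theta> *v x)) =
      (\<Sum>\<theta> | eigenvalue H \<theta>. c \<theta> *s (?E \<eta> *v (?E \<theta> *v x)))"
    by (simp add: linear_sum[OF linear_matrix_vector_complex] vec.scale)
  also have "\<dots> = (\<Sum>\<theta> | eigenvalue H \<theta>. if \<theta> = \<eta> then c \<eta> *s (?E \<eta> *v x) else 0)"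
    using eigenprojection_fix[OF eigenprojection_in] eigenprojection_other[OF H eigenprojection_in]
    by (intro sum.cong) auto
  finally show ?thesis using \<eta> finite_eigenvalues[OF H] by simp
qed

text \<open>The common kernel \<open>S\<close> of all eigenprojections is invariant under
  \<open>H\<close>. If it were nonzero it would contain an eigenvector, both fixed and killed by its
  own eigenprojection. The difference of the two sides lies in \<open>S\<close>.\<close>

lemma eigenprojection_resolution:
  assumes H: "hermitian H"
  shows "(\<Sum>\<theta> | eigenvalue H \<theta>. eigenprojection H \<theta> *v x) = x"
proof -
  let ?L = "{\<theta>. eigenvalue H \<theta>}" and ?E = "eigenprojection H"
  define S where "S = {y. \<forall>\<theta>\<in>?L. ?E \<theta> *v y = 0}"
  have "subspace S"
    unfolding subspace_def S_def
    by (auto simp: matrix_vector_right_distrib scaleR_vec_complex vec.scale)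
  moreover have "H *v y \<in> S" if "y \<in> S" for y
  proof -
    have "?E \<theta> *v (H *v y) = 0" if "\<theta> \<in> ?L" for \<theta>
    proof -
      let ?w = "?E \<theta> *v (H *v y)"
      \<comment> \<open>Moved across the inner product, \<open>H\<close> acts on a vector of the
        eigenspace as the scalar \<theta>; the projection then moves back onto \<open>y\<close>,
        which it kills.\<close>
      have "?w \<bullet> ?w = y \<bullet> (H *v (?E \<theta> *v ?w))"
        by (simp add: hermitian_inner[OF hermitian_eigenprojection] hermitian_inner[OF H])
      also have "\<dots> = \<theta> * (y \<bullet> (?E \<theta> *v ?w))"
        by (simp add: eigenprojection_eigen scaleR_vec_complex[symmetric])
      also have "y \<bullet> (?E \<theta> *v ?w) = (?E \<theta> *v y) \<bullet> ?w"
        by (simp add: hermitian_inner[OF hermitian_eigenprojection])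
      also have "?E \<theta> *v y = 0" using \<open>y \<in> S\<close> that by (simp add: S_def)
      finally show ?thesis by simp
    qed
    thus ?thesis by (simp add: S_def)
  qed
  ultimately have S0: "S = {0}"
  proof (rule_tac ccontr)
    assume *: "subspace S" "\<And>y. y \<in> S \<Longrightarrow> H *v y \<in> S" "S \<noteq> {0}"
    obtain \<mu> v where v: "v \<in> S" "v \<noteq> 0" "H *v v = \<mu> *\<^sub>R v"
      using symmetric_eigenvector_exists[OF linear_matrix_vector_complex hermitian_inner[OF H] *]
      by blast
    have "v \<in> eigenspace H \<mu>" using v by (simp add: eigenspace_def scaleR_vec_complex)
    moreover from this have "\<mu> \<in> ?L" using v by (auto simp: eigenvalue_def)
    ultimately show False using v eigenprojection_fix[of v H \<mu>] by (simp add: S_def)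
  qed
  have "x - (\<Sum>\<theta>\<in>?L. ?E \<theta> *v x) \<in> S"
  proof -
    have "?E \<eta> *v (\<Sum>\<theta>\<in>?L. ?E \<theta> *v x) = ?E \<eta> *v x" if "\<eta> \<in> ?L" for \<eta>
      using eigenprojection_combination[OF H, of \<eta> "\<lambda>_. 1" x] that by simp
    thus ?thesis by (simp add: S_def linear_diff[OF linear_matrix_vector_complex])
  qed
  thus ?thesis using S0 by simp
qed

text \<open>By Pythagoras the norm does not depend on the unimodular coefficients, and for
  coefficients 1 the sum is \<open>x\<close> itself.\<close>

lemma eigenprojection_combination_norm:
  assumes H: "hermitian H" and c: "\<And>\<theta>. eigenvalue H \<theta> \<Longrightarrow> cmod (c \<theta>) = 1"
  shows "norm (\<Sum>\<theta> | eigenvalue H \<theta>. c \<theta> *s (eigenprojection H \<theta> *v x)) = norm x"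
proof -
  let ?E = "eigenprojection H"
  have norm_scale: "norm (z *s v) = cmod z * norm v" for z and v :: "complex^'a"
    by (simp add: norm_vec_def norm_mult L2_set_right_distrib)
  have orth: "pairwise (\<lambda>\<theta> \<eta>. orthogonal (k \<theta> *s (?E \<theta> *v x)) (k \<eta> *s (?E \<eta> *v x))) {\<theta>. eigenvalue H \<theta>}"
    for k
  proof -
    have "k \<theta> *s (?E \<theta> *v x) \<in> eigenspace H \<theta>" for \<theta>
      by (metis eigenprojection_in vec.scale)
    thus ?thesis
      unfolding pairwise_def orthogonal_def by (blast intro: eigenspace_orthogonal[OF H])
  qed
  have pyth: "(norm (\<Sum>\<theta> | eigenvalue H \<theta>. k \<theta> *s (?E \<theta> *v x)))\<^sup>2 =
      (\<Sum>\<theta> | eigenvalue H \<theta>. (norm (?E \<theta> *v x))\<^sup>2)"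
    if "\<And>\<theta>. eigenvalue H \<theta> \<Longrightarrow> cmod (k \<theta>) = 1" for k
    unfolding norm_sum_Pythagorean[OF finite_eigenvalues[OF H] orth]
    using that by (intro sum.cong) (auto simp: norm_scale)
  have "(norm (\<Sum>\<theta> | eigenvalue H \<theta>. c \<theta> *s (?E \<theta> *v x)))\<^sup>2 = (norm x)\<^sup>2"
    using pyth[of c] pyth[of "\<lambda>_. 1"] c eigenprojection_resolution[OF H, of x] by simp
  thus ?thesis by simp
qed

text \<open>On each eigenspace the exponent \<open>A\<close> acts as a scalar, so its powers are
  explicit combinations of the eigenprojections and the matrix series reduces to scalar exponential
  series.\<close>

lemma transition_matrix_spectral:
  assumes H: "hermitian H"
  shows "transition_matrix H t $ i $ j =
    (\<Sum>\<theta> | eigenvalue H \<theta>. cis (- (t * \<theta>)) * (eigenprojection H \<theta> *v axis j 1) $ i)"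
proof -
  let ?E = "eigenprojection H" and ?L = "{\<theta>. eigenvalue H \<theta>}"
  define c where "c = - \<i> * complex_of_real t"
  define A where "A = map_matrix ((*) c) H"
  have A: "A *v x = c *s (H *v x)" for x
    by (simp add: A_def map_matrix_def matrix_vector_mult_def vec_eq_iff sum_distrib_left mult.assoc)
  have entry: "M $ p $ q = (M *v axis q 1) $ p" for M :: "complex^'a^'a" and p q
    by (simp add: matrix_vector_mult_def axis_def if_distrib[of "(*) _"] cong: if_cong)
  have pow: "((**) A ^^ k) (mat 1) *v x = (\<Sum>\<theta>\<in>?L. (c * \<theta>) ^ k *s (?E \<theta> *v x))" for k x
  proof (induction k)
    case 0
    show ?case using eigenprojection_resolution[OF H] by simp
  next
    case (Suc k)
    have "((**) A ^^ Suc k) (mat 1) *v x = A *v (\<Sum>\<theta>\<in>?L. (c * \<theta>) ^ k *s (?E \<theta> *v x))"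
      by (simp add: matrix_vector_mul_assoc[symmetric] Suc)
    also have "\<dots> = (\<Sum>\<theta>\<in>?L. (c * \<theta>) ^ k *s (c *s (H *v (?E \<theta> *v x))))"
      by (simp add: linear_sum[OF linear_matrix_vector_complex] vec.scale A)
    also have "\<dots> = (\<Sum>\<theta>\<in>?L. (c * \<theta>) ^ Suc k *s (?E \<theta> *v x))"
      by (simp add: eigenprojection_eigen vector_smult_assoc mult_ac)
    finally show ?case .
  qed
  define B :: "complex^'a^'a" where "B = (\<chi> p q. \<Sum>\<theta>\<in>?L. exp (c * \<theta>) * (?E \<theta> *v axis q 1) $ p)"
  have "(\<lambda>k. (1 / fact k) *\<^sub>R ((**) A ^^ k) (mat 1)) sums B"
    unfolding sums_def
  proof (intro vec_tendstoI)
    fix p q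
    have "(\<lambda>k. \<Sum>\<theta>\<in>?L. ((c * \<theta>) ^ k /\<^sub>R fact k) * (?E \<theta> *v axis q 1) $ p) sums (B $ p $ q)"
      unfolding B_def vec_lambda_beta by (intro sums_sum sums_mult2 exp_converges)
    moreover have "((1 / fact k) *\<^sub>R ((**) A ^^ k) (mat 1)) $ p $ q =
        (\<Sum>\<theta>\<in>?L. ((c * \<theta>) ^ k /\<^sub>R fact k) * (?E \<theta> *v axis q 1) $ p)" for k
      by (simp add: entry[of "((**) A ^^ k) (mat 1)"] pow scaleR_sum_right divide_inverse)
    ultimately show "(\<lambda>n. (\<Sum>k<n. (1 / fact k) *\<^sub>R ((**) A ^^ k) (mat 1)) $ p $ q) \<longlonglongrightarrow> B $ p $ q"
      by (simp add: sums_def)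
  qed
  hence "transition_matrix H t = B"
    unfolding transition_matrix_def matrix_exp_def by (simp add: A_def c_def sums_iff)
  moreover have "exp (c * \<theta>) = cis (- (t * \<theta>))" for \<theta>
    by (simp add: c_def cis_conv_exp algebra_simps)
  ultimately show ?thesis by (simp add: B_def)
qed

section \<open>Pretty good state transfer\<close>

text \<open>Bolzano-Weierstrass once per index; limits already obtained survive the passage to a
  further subsequence.\<close>

lemma finite_family_convergent_subsequence:
  fixes f :: "'a \<Rightarrow> nat \<Rightarrow> 'b::heine_borel"
  assumes "finite I" "\<And>i. i \<in> I \<Longrightarrow> bounded (range (f i))"
  shows "\<exists>r \<zeta>. strict_mono r \<and> (\<forall>i\<in>I. (\<lambda>n. f i (r n)) \<longlonglongrightarrow> \<zeta> i)"
  using assms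
proof (induction I rule: finite_induct)
  case empty
  show ?case using strict_mono_id by auto
next
  case (insert i I)
  then obtain r \<zeta> where r: "strict_mono r" "\<And>j. j \<in> I \<Longrightarrow> (\<lambda>n. f j (r n)) \<longlonglongrightarrow> \<zeta> j" by auto
  have "bounded (range (f i \<circ> r))"
    using insert.prems[of i] by (rule bounded_subset) auto
  then obtain l s where s: "strict_mono s" "((f i \<circ> r) \<circ> s) \<longlonglongrightarrow> l"
    using bounded_imp_convergent_subsequence by metis
  have "(\<lambda>n. f j ((r \<circ> s) n)) \<longlonglongrightarrow> (\<zeta>(i := l)) j" if "j \<in> insert i I" for j
    using s(2) LIMSEQ_subseq_LIMSEQ[OF r(2) s(1), of j] that insert.hyps by (auto simp: o_def)
  thus ?case using strict_mono_o[OF r(1) s(1)] by blast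
qed

text \<open>The squared moduli of the entries sum to 1, and the entry at \<open>a\<close> already
  accounts for all of it.\<close>

lemma unit_vector_eq_axis:
  fixes x :: "complex^'n"
  assumes "norm x = 1" "cmod (x $ a) \<ge> 1"
  shows "cmod (x $ a) = 1" "x = x $ a *s axis a 1"
proof -
  have "1 = (norm x)\<^sup>2" using assms by simp
  also have "\<dots> = (\<Sum>i\<in>UNIV. (cmod (x $ i))\<^sup>2)"
    by (simp add: norm_vec_def L2_set_def sum_nonneg)
  also have "\<dots> = (cmod (x $ a))\<^sup>2 + (\<Sum>i\<in>-{a}. (cmod (x $ i))\<^sup>2)"
    by (simp add: sum.remove[of UNIV a] Compl_eq_Diff_UNIV)
  finally have 1: "1 = (cmod (x $ a))\<^sup>2 + (\<Sum>i\<in>-{a}. (cmod (x $ i))\<^sup>2)" .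
  have 2: "(\<Sum>i\<in>-{a}. (cmod (x $ i))\<^sup>2) \<ge> 0" by (intro sum_nonneg) auto
  have 3: "(cmod (x $ a))\<^sup>2 \<ge> 1" using assms by simp
  with 1 2 have "(cmod (x $ a))\<^sup>2 = 1" "(\<Sum>i\<in>-{a}. (cmod (x $ i))\<^sup>2) = 0" by linarith+
  thus "cmod (x $ a) = 1" "x = x $ a *s axis a 1"
    using norm_ge_zero[of "x $ a"]
    by (auto simp: power2_eq_1_iff sum_nonneg_eq_0_iff vec_eq_iff axis_def simp del: norm_ge_zero)
qed

text \<open>The compactness argument; \<gamma> is the \<open>a\<close>-entry of the limit vector.
  The times \<open>t\<close> stay in the conclusion so that integer relations can later be passed to
  the limit.\<close>

lemma pretty_good_state_transfer_limit:
  assumes H: "hermitian H" and pgst: "pretty_good_state_transfer H a b"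
  obtains t \<zeta> \<gamma> where
    "\<And>\<theta>. eigenvalue H \<theta> \<Longrightarrow> (\<lambda>n. cis (- (t n * \<theta>))) \<longlonglongrightarrow> \<zeta> \<theta>"
    "\<And>\<theta>. eigenvalue H \<theta> \<Longrightarrow> cmod (\<zeta> \<theta>) = 1" "cmod \<gamma> = 1"
    "\<And>\<theta>. eigenvalue H \<theta> \<Longrightarrow>
      eigenprojection H \<theta> *v axis a 1 = (\<zeta> \<theta> / \<gamma>) *s (eigenprojection H \<theta> *v axis b 1)"
proof -
  let ?E = "eigenprojection H" and ?L = "{\<theta>. eigenvalue H \<theta>}"
  have "\<exists>t. cmod (transition_matrix H t $ a $ b) \<ge> 1 - inverse (real (Suc n))" for n
    using pgst unfolding pretty_good_state_transfer_def by simp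
  then obtain t where t: "\<And>n. cmod (transition_matrix H (t n) $ a $ b) \<ge> 1 - inverse (real (Suc n))"
    by metis
  have "bounded (range (\<lambda>n. cis (- (t n * \<theta>))))" for \<theta>
    by (rule boundedI[of _ 1]) auto
  then obtain r \<zeta> where r: "strict_mono r"
    and \<zeta>: "\<And>\<theta>. \<theta> \<in> ?L \<Longrightarrow> (\<lambda>n. cis (- (t (r n) * \<theta>))) \<longlonglongrightarrow> \<zeta> \<theta>"
    using finite_family_convergent_subsequence[OF finite_eigenvalues[OF H],
        of "\<lambda>\<theta> n. cis (- (t n * \<theta>))"] by auto
  have \<zeta>1: "cmod (\<zeta> \<theta>) = 1" if "\<theta> \<in> ?L" for \<theta>
    using LIMSEQ_unique[OF tendsto_norm[OF \<zeta>[OF that]]] by simp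
  define x where "x = (\<Sum>\<theta>\<in>?L. \<zeta> \<theta> *s (?E \<theta> *v axis b 1))"
  have "(\<lambda>n. transition_matrix H (t (r n)) $ a $ b) \<longlonglongrightarrow> x $ a"
    unfolding x_def transition_matrix_spectral[OF H] by (auto intro!: tendsto_intros \<zeta>)
  moreover have "(\<lambda>n. 1 - inverse (real (Suc (r n)))) \<longlonglongrightarrow> 1 - 0"
    using LIMSEQ_subseq_LIMSEQ[OF LIMSEQ_inverse_real_of_nat r]
    by (intro tendsto_diff tendsto_const) (simp add: o_def)
  ultimately have "1 - 0 \<le> cmod (x $ a)"
    by (intro tendsto_le[OF sequentially_bot tendsto_norm _ always_eventually]) (use t in auto)
  moreover have "norm x = 1"
    unfolding x_def using eigenprojection_combination_norm[OF H, of \<zeta>] \<zeta>1 by simp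
  ultimately have x: "cmod (x $ a) = 1" "x = x $ a *s axis a 1"
    using unit_vector_eq_axis[of x a] by auto
  have "?E \<theta> *v axis a 1 = (\<zeta> \<theta> / x $ a) *s (?E \<theta> *v axis b 1)" if "\<theta> \<in> ?L" for \<theta>
  proof -
    \<comment> \<open>The projection of the limit vector is evaluated twice: from \<open>x\<close>
      as a multiple of the basis vector at \<open>a\<close>, and from its definition as a
      combination of projections.\<close>
    have "x $ a *s (?E \<theta> *v axis a 1) = ?E \<theta> *v x" by (metis vec.scale x(2))
    also have "\<dots> = \<zeta> \<theta> *s (?E \<theta> *v axis b 1)"
      unfolding x_def using eigenprojection_combination[OF H] that by blast
    finally have "(1 / x $ a) *s (x $ a *s (?E \<theta> *v axis a 1)) =
      (1 / x $ a) *s (\<zeta> \<theta> *s (?E \<theta> *v axis b 1))" by simp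
    moreover have "x $ a \<noteq> 0" using x(1) by auto
    ultimately show ?thesis by (simp add: vector_smult_assoc)
  qed
  thus thesis using that[of "t \<circ> r" \<zeta> "x $ a"] \<zeta> \<zeta>1 x(1) by simp
qed

lemma is_quarrel_if_cis:
  assumes "eigenprojection H \<theta> *v axis a 1 = z *s (eigenprojection H \<theta> *v axis b 1)" "cmod z = 1"
  shows "is_quarrel H a b \<theta> (Arg2pi z)"
  using assms Arg2pi_ge_0[of z] Arg2pi_lt_2pi[of z] Arg2pi_eq[of z]
  by (simp add: is_quarrel_def cis_conv_exp)

lemma quarrel_eq:
  assumes "\<theta> \<in> eigenvalue_support H a" "is_quarrel H a b \<theta> q"
  shows "quarrel H a b \<theta> = q"
  unfolding quarrel_def using assms is_quarrel_unique by blast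

lemma cis_sum: "finite I \<Longrightarrow> cis (\<Sum>i\<in>I. f i) = (\<Prod>i\<in>I. cis (f i))"
  by (induction I rule: finite_induct) (auto simp: cis_mult[symmetric])

lemma pretty_good_state_transfer_imp:
  assumes H: "hermitian H" and pgst: "pretty_good_state_transfer H a b"
  shows "strongly_cospectral H a b"
    and "\<exists>\<delta>::real. \<forall>l :: real \<Rightarrow> int.
       (\<Sum>\<theta>\<in>eigenvalue_support H a. of_int (l \<theta>) * \<theta>) = 0 \<longrightarrow>
       [(\<Sum>\<theta>\<in>eigenvalue_support H a. of_int (l \<theta>) * (quarrel H a b \<theta> + \<delta>)) = 0] (rmod (2 * pi))"
proof -
  let ?P = "eigenvalue_support H a"
  obtain t \<zeta> \<gamma> where lim: "\<And>\<theta>. eigenvalue H \<theta> \<Longrightarrow> (\<lambda>n. cis (- (t n * \<theta>))) \<longlonglongrightarrow> \<zeta> \<theta>"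
    and unit: "\<And>\<theta>. eigenvalue H \<theta> \<Longrightarrow> cmod (\<zeta> \<theta>) = 1" "cmod \<gamma> = 1"
    and proj: "\<And>\<theta>. eigenvalue H \<theta> \<Longrightarrow>
      eigenprojection H \<theta> *v axis a 1 = (\<zeta> \<theta> / \<gamma>) *s (eigenprojection H \<theta> *v axis b 1)"
    using pretty_good_state_transfer_limit[OF H pgst] by metis
  have quarrel: "is_quarrel H a b \<theta> (Arg2pi (\<zeta> \<theta> / \<gamma>))" if "eigenvalue H \<theta>" for \<theta>
    using is_quarrel_if_cis[OF proj] unit that by (simp add: norm_divide)
  thus "strongly_cospectral H a b" unfolding strongly_cospectral_def by blast
  note fin = finite_eigenvalue_support[OF H, of a]
  \<comment> \<open>The quarrel is the argument of \<open>\<zeta> \<theta> / \<gamma>\<close>, so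
    adding that of \<gamma> recovers the limit phase; this determines \<delta>.\<close>
  have \<zeta>: "cis (quarrel H a b \<theta> + Arg2pi \<gamma>) = \<zeta> \<theta>" if "\<theta> \<in> ?P" for \<theta>
  proof -
    have \<theta>: "eigenvalue H \<theta>" using that by (simp add: eigenvalue_support_def)
    have polar: "cis (Arg2pi z) = z" if "cmod z = 1" for z
      using Arg2pi_eq[of z] that by (simp add: cis_conv_exp)
    have "\<gamma> \<noteq> 0" using unit by auto
    thus ?thesis
      using unit \<theta> by (simp add: quarrel_eq[OF that quarrel[OF \<theta>]] cis_mult[symmetric] polar norm_divide)
  qed
  show "\<exists>\<delta>::real. \<forall>l :: real \<Rightarrow> int. (\<Sum>\<theta>\<in>?P. of_int (l \<theta>) * \<theta>) = 0 \<longrightarrow>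
       [(\<Sum>\<theta>\<in>?P. of_int (l \<theta>) * (quarrel H a b \<theta> + \<delta>)) = 0] (rmod (2 * pi))"
  proof (intro exI[of _ "Arg2pi \<gamma>"] allI impI)
    fix l :: "real \<Rightarrow> int" assume l: "(\<Sum>\<theta>\<in>?P. of_int (l \<theta>) * \<theta>) = 0"
    \<comment> \<open>A relation makes this product 1 at every time. Negative exponents cause no
      trouble in the limit because the limit phases are nonzero.\<close>
    have "(\<lambda>n. \<Prod>\<theta>\<in>?P. cis (- (t n * \<theta>)) powi l \<theta>) \<longlonglongrightarrow> (\<Prod>\<theta>\<in>?P. \<zeta> \<theta> powi l \<theta>)"
      using unit(1) by (intro tendsto_prod tendsto_power_int lim) (force simp: eigenvalue_support_def)+
    moreover have "(\<Prod>\<theta>\<in>?P. cis (- (t n * \<theta>)) powi l \<theta>) = 1" for n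
    proof -
      have "(\<Prod>\<theta>\<in>?P. cis (- (t n * \<theta>)) powi l \<theta>) = cis (\<Sum>\<theta>\<in>?P. - t n * (of_int (l \<theta>) * \<theta>))"
        unfolding cis_sum[OF fin] by (intro prod.cong) (auto simp: cis_power_int mult_ac)
      also have "\<dots> = 1" unfolding sum_distrib_left[symmetric] l by simp
      finally show ?thesis .
    qed
    ultimately have "(\<Prod>\<theta>\<in>?P. \<zeta> \<theta> powi l \<theta>) = 1" by (simp add: LIMSEQ_const_iff)
    moreover have "(\<Prod>\<theta>\<in>?P. \<zeta> \<theta> powi l \<theta>) = cis (\<Sum>\<theta>\<in>?P. of_int (l \<theta>) * (quarrel H a b \<theta> + Arg2pi \<gamma>))"
      unfolding cis_sum[OF fin] by (intro prod.cong) (auto simp: \<zeta>[symmetric] cis_power_int)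
    ultimately show "[(\<Sum>\<theta>\<in>?P. of_int (l \<theta>) * (quarrel H a b \<theta> + Arg2pi \<gamma>)) = 0] (rmod (2 * pi))"
      by (simp add: cis_eq_iff[symmetric])
  qed
qed

section \<open>Sufficiency: approximating the ideal phases\<close>

text \<open>Factoring out \<open>cis y\<close> leaves a chord of length
  \<open>2 * \<bar>sin ((x - y) / 2)\<bar>\<close>, which the arc bounds.\<close>

lemma norm_cis_diff_le: "cmod (cis x - cis y) \<le> \<bar>x - y\<bar>"
proof -
  have "cis x - cis y = cis y * (exp (\<i> * of_real (x - y)) - 1)"
    by (simp add: cis_conv_exp algebra_simps exp_add[symmetric])
  hence "cmod (cis x - cis y) = 2 * \<bar>sin ((x - y) / 2)\<bar>"
    by (simp only: norm_mult norm_cis dist_exp_i_1 mult_1)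
  also have "\<dots> \<le> \<bar>x - y\<bar>" using abs_sin_x_le_abs_x[of "(x - y) / 2"] by simp
  finally show ?thesis .
qed

lemma pretty_good_state_transfer_if:
  assumes H: "hermitian H" and sc: "strongly_cospectral H a b"
    and rel: "\<And>l :: real \<Rightarrow> int. (\<Sum>\<theta>\<in>eigenvalue_support H a. of_int (l \<theta>) * \<theta>) = 0 \<Longrightarrow>
       [(\<Sum>\<theta>\<in>eigenvalue_support H a. of_int (l \<theta>) * (quarrel H a b \<theta> + \<delta>)) = 0] (rmod (2 * pi))"
  shows "pretty_good_state_transfer H a b"
  unfolding pretty_good_state_transfer_def
proof (intro allI impI)
  let ?P = "eigenvalue_support H a" and ?E = "eigenprojection H"
  fix \<epsilon> :: real assume \<epsilon>: "\<epsilon> > 0"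
  define q where "q \<theta> = quarrel H a b \<theta>" for \<theta>
  note fin = finite_eigenvalue_support[OF H, of a]
  have q: "?E \<theta> *v axis a 1 = cis (q \<theta>) *s (?E \<theta> *v axis b 1)" if \<theta>: "\<theta> \<in> ?P" for \<theta>
  proof -
    obtain q' where "is_quarrel H a b \<theta> q'"
      using sc \<theta> unfolding strongly_cospectral_def eigenvalue_support_def by blast
    with quarrel_eq[OF \<theta> this] show ?thesis by (simp add: is_quarrel_def q_def)
  qed
  \<comment> \<open>Strong cospectrality covers all eigenvalues, so off the support of
    \<open>a\<close> the projection of the basis vector at \<open>b\<close> vanishes too and all
    sums reduce to the support.\<close>
  have outside: "?E \<theta> *v axis b 1 = 0" "?E \<theta> *v axis a 1 = 0" if \<theta>: "eigenvalue H \<theta>" "\<theta> \<notin> ?P" for \<theta>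
  proof -
    show 0: "?E \<theta> *v axis a 1 = 0" using \<theta> by (simp add: eigenvalue_support_def)
    obtain q' where "?E \<theta> *v axis a 1 = cis q' *s (?E \<theta> *v axis b 1)"
      using sc \<theta> unfolding strongly_cospectral_def is_quarrel_def by blast
    with 0 show "?E \<theta> *v axis b 1 = 0" by simp
  qed
  have restrict: "(\<Sum>\<theta> | eigenvalue H \<theta>. g \<theta>) = (\<Sum>\<theta>\<in>?P. g \<theta>)"
    if "\<And>\<theta>. eigenvalue H \<theta> \<Longrightarrow> \<theta> \<notin> ?P \<Longrightarrow> g \<theta> = 0" for g :: "real \<Rightarrow> complex"
    by (rule sum.mono_neutral_right[OF finite_eigenvalues[OF H]])
       (use that in \<open>auto simp: eigenvalue_support_def\<close>)
  define w where "w \<theta> = (?E \<theta> *v axis b 1) $ a" for \<theta>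
  have U: "transition_matrix H t $ a $ b = (\<Sum>\<theta>\<in>?P. cis (- (t * \<theta>)) * w \<theta>)" for t
    unfolding transition_matrix_spectral[OF H] w_def by (rule restrict) (simp add: outside)
  \<comment> \<open>With the quarrels as phases, the projections at \<open>b\<close> become those at
    \<open>a\<close>, which add up to the basis vector at \<open>a\<close>.\<close>
  have "(\<Sum>\<theta>\<in>?P. cis (q \<theta>) * w \<theta>) = (\<Sum>\<theta>\<in>?P. (?E \<theta> *v axis a 1) $ a)"
    by (intro sum.cong) (auto simp: q w_def)
  also have "\<dots> = (\<Sum>\<theta> | eigenvalue H \<theta>. (?E \<theta> *v axis a 1) $ a)"
    by (rule restrict[symmetric]) (simp add: outside)
  also have "\<dots> = (\<Sum>\<theta> | eigenvalue H \<theta>. ?E \<theta> *v axis a 1) $ a" by simp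
  also have "\<dots> = 1" unfolding eigenprojection_resolution[OF H] by simp
  finally have one: "(\<Sum>\<theta>\<in>?P. cis (q \<theta>) * w \<theta>) = 1" .
  have ideal: "(\<Sum>\<theta>\<in>?P. cis (q \<theta> + \<delta>) * w \<theta>) = cis \<delta>"
  proof -
    have "(\<Sum>\<theta>\<in>?P. cis (q \<theta> + \<delta>) * w \<theta>) = cis \<delta> * (\<Sum>\<theta>\<in>?P. cis (q \<theta>) * w \<theta>)"
      by (simp add: sum_distrib_left cis_mult[symmetric] mult_ac)
    thus ?thesis by (simp add: one)
  qed
  \<comment> \<open>Approximation is modulo 1 and the phases of \<open>U\<close> are
    \<open>cis (- (\<tau> * \<theta>))\<close>. With \<open>\<tau> = 2 * pi * t\<close> the target
    angle \<open>q \<theta> + \<delta>\<close> becomes this value.\<close>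
  define \<alpha> where "\<alpha> \<theta> = - (q \<theta> + \<delta>) / (2 * pi)" for \<theta>
  have "kronecker_approximable ?P (\<lambda>\<theta>. \<theta>) \<alpha>"
  proof (rule kronecker_approximable_if_relations[OF fin])
    fix l :: "real \<Rightarrow> int" assume "(\<Sum>\<theta>\<in>?P. of_int (l \<theta>) * \<theta>) = 0"
    then obtain n where "0 = (\<Sum>\<theta>\<in>?P. of_int (l \<theta>) * (q \<theta> + \<delta>)) + of_int n * (2 * pi)"
      using rel unfolding rcong_altdef q_def by blast
    hence "(\<Sum>\<theta>\<in>?P. of_int (l \<theta>) * (q \<theta> + \<delta>)) = - (of_int n * (2 * pi))" by linarith
    moreover have "(\<Sum>\<theta>\<in>?P. of_int (l \<theta>) * \<alpha> \<theta>) =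
        (- 1 / (2 * pi)) * (\<Sum>\<theta>\<in>?P. of_int (l \<theta>) * (q \<theta> + \<delta>))"
      unfolding sum_distrib_left by (intro sum.cong) (auto simp: \<alpha>_def field_simps)
    ultimately have "(\<Sum>\<theta>\<in>?P. of_int (l \<theta>) * \<alpha> \<theta>) = of_int n" by simp
    thus "(\<Sum>\<theta>\<in>?P. of_int (l \<theta>) * \<alpha> \<theta>) \<in> \<int>" by simp
  qed
  moreover define M where "M = (\<Sum>\<theta>\<in>?P. cmod (w \<theta>))"
  have M: "M \<ge> 0" unfolding M_def by (intro sum_nonneg) auto
  \<comment> \<open>Each phase will be off by at most \<open>2 * pi * \<epsilon>'\<close> and the
    weights total \<open>M\<close>; \<open>M + 1\<close> keeps the denominator positive.\<close>
  define \<epsilon>' where "\<epsilon>' = \<epsilon> / (2 * pi * (M + 1))"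
  have \<epsilon>': "\<epsilon>' > 0" using \<epsilon> M by (simp add: \<epsilon>'_def)
  ultimately obtain t h where th: "\<And>\<theta>. \<theta> \<in> ?P \<Longrightarrow> \<bar>t * \<theta> - of_int (h \<theta>) - \<alpha> \<theta>\<bar> < \<epsilon>'"
    unfolding kronecker_approximable_def by blast
  have close: "cmod (cis (- (2 * pi * t * \<theta>)) - cis (q \<theta> + \<delta>)) \<le> 2 * pi * \<epsilon>'" if "\<theta> \<in> ?P" for \<theta>
  proof -
    have "cis (q \<theta> + \<delta>) = cis (q \<theta> + \<delta> - 2 * pi * of_int (h \<theta>))"
      by (simp add: cis_divide[symmetric])
    hence "cmod (cis (- (2 * pi * t * \<theta>)) - cis (q \<theta> + \<delta>)) \<le>
        \<bar>- (2 * pi * t * \<theta>) - (q \<theta> + \<delta> - 2 * pi * of_int (h \<theta>))\<bar>"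
      using norm_cis_diff_le by metis
    also have "\<dots> = \<bar>- (2 * pi) * (t * \<theta> - of_int (h \<theta>) - \<alpha> \<theta>)\<bar>"
      by (intro arg_cong[where f = abs]) (simp add: \<alpha>_def field_simps)
    also have "\<dots> = 2 * pi * \<bar>t * \<theta> - of_int (h \<theta>) - \<alpha> \<theta>\<bar>" by (simp add: abs_mult)
    also have "\<dots> \<le> 2 * pi * \<epsilon>'" using th[OF that] by simp
    finally show ?thesis .
  qed
  have "cmod (transition_matrix H (2 * pi * t) $ a $ b - cis \<delta>) =
      cmod (\<Sum>\<theta>\<in>?P. (cis (- (2 * pi * t * \<theta>)) - cis (q \<theta> + \<delta>)) * w \<theta>)"
    unfolding U ideal[symmetric] by (simp add: sum_subtractf left_diff_distrib)
  also have "\<dots> \<le> (\<Sum>\<theta>\<in>?P. 2 * pi * \<epsilon>' * cmod (w \<theta>))"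
    by (rule sum_norm_le) (auto simp: norm_mult intro!: mult_right_mono close)
  also have "\<dots> = 2 * pi * \<epsilon>' * M" by (simp add: M_def sum_distrib_left)
  also have "\<dots> \<le> 2 * pi * \<epsilon>' * (M + 1)" using \<epsilon>' by (intro mult_left_mono) auto
  also have "\<dots> = \<epsilon>" using M by (simp add: \<epsilon>'_def)
  finally have "cmod (transition_matrix H (2 * pi * t) $ a $ b) \<ge> 1 - \<epsilon>"
    using norm_triangle_ineq2[of "cis \<delta>" "transition_matrix H (2 * pi * t) $ a $ b"]
    by (simp add: norm_minus_commute)
  thus "\<exists>\<tau>. cmod (transition_matrix H \<tau> $ a $ b) \<ge> 1 - \<epsilon>" by blast
qed

text \<open>The two implications are proved with relations indexed by the support itself; it remains
  to transport coefficient families along the enumeration \<theta>.\<close>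

theorem theorem2p4:
  fixes H :: "complex^'n^'n" and a b :: 'n and d :: nat and \<theta> :: "nat \<Rightarrow> real"
  assumes "hermitian H"
    and "bij_betw \<theta> {1..d} (eigenvalue_support H a)"
  shows "pretty_good_state_transfer H a b \<longleftrightarrow>
    strongly_cospectral H a b \<and>
    (\<exists>\<delta>::real. \<forall>l :: nat \<Rightarrow> int.
       (\<Sum>r=1..d. of_int (l r) * \<theta> r) = 0 \<longrightarrow>
       [(\<Sum>r=1..d. of_int (l r) * (quarrel H a b (\<theta> r) + \<delta>)) = 0] (rmod (2 * pi)))"
    (is "?pgst \<longleftrightarrow> ?sc \<and> (\<exists>\<delta>. \<forall>l. ?rel \<delta> l)")
proof -
  let ?P = "eigenvalue_support H a" and ?inv = "inv_into {1..d} \<theta>"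
  have reindex: "(\<Sum>r=1..d. of_int (l (\<theta> r)) * f (\<theta> r)) = (\<Sum>\<eta>\<in>?P. of_int (l \<eta>) * f \<eta>)"
    for l :: "real \<Rightarrow> int" and f :: "real \<Rightarrow> real"
    by (rule sum.reindex_bij_betw[OF assms(2)])
  \<comment> \<open>Coefficients given on \<open>{1..d}\<close> become a function on eigenvalues
    through the inverse of the enumeration.\<close>
  have reindex': "(\<Sum>r=1..d. of_int (l r) * f (\<theta> r)) = (\<Sum>\<eta>\<in>?P. of_int (l (?inv \<eta>)) * f \<eta>)"
    for l :: "nat \<Rightarrow> int" and f :: "real \<Rightarrow> real"
    unfolding reindex[of "l \<circ> ?inv", unfolded o_def, symmetric]
    using bij_betw_inv_into_left[OF assms(2)] by (intro sum.cong) auto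
  show ?thesis
  proof (intro iffI conjI)
    assume ?pgst
    from pretty_good_state_transfer_imp(2)[OF assms(1) this]
    obtain \<delta> where \<delta>: "\<And>l :: real \<Rightarrow> int. (\<Sum>\<eta>\<in>?P. of_int (l \<eta>) * \<eta>) = 0 \<Longrightarrow>
       [(\<Sum>\<eta>\<in>?P. of_int (l \<eta>) * (quarrel H a b \<eta> + \<delta>)) = 0] (rmod (2 * pi))"
      by blast
    have "?rel \<delta> l" for l
      using \<delta>[of "l \<circ> ?inv"] reindex'[of l "\<lambda>\<eta>. \<eta>"] reindex'[of l "\<lambda>\<eta>. quarrel H a b \<eta> + \<delta>"]
      by simp
    thus "\<exists>\<delta>. \<forall>l. ?rel \<delta> l" by blast
  next
    assume "?sc \<and> (\<exists>\<delta>. \<forall>l. ?rel \<delta> l)"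
    then obtain \<delta> where sc: ?sc and \<delta>: "\<And>l. ?rel \<delta> l" by blast
    show ?pgst
    proof (rule pretty_good_state_transfer_if[OF assms(1) sc, where \<delta> = \<delta>])
      fix l :: "real \<Rightarrow> int" assume "(\<Sum>\<eta>\<in>?P. of_int (l \<eta>) * \<eta>) = 0"
      thus "[(\<Sum>\<eta>\<in>?P. of_int (l \<eta>) * (quarrel H a b \<eta> + \<delta>)) = 0] (rmod (2 * pi))"
        using \<delta>[of "l \<circ> \<theta>"] reindex[of l "\<lambda>\<eta>. \<eta>"] reindex[of l "\<lambda>\<eta>. quarrel H a b \<eta> + \<delta>"]
        by simp
    qed
  qed (rule pretty_good_state_transfer_imp(1)[OF assms(1)])
qed

end
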